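(* Let $n$ be a positive integer and let $O(n)$ be the symmetric Jordan basis of $V(B(n))$ produced by the linear BTK algorithm applied to the Boolean algebra $B(n)$ (defined in the context). Let $\langle\,,\rangle$ be the standard inner product on $V(B(n))$ and $\|v\|=\sqrt{\langle v,v\rangle}$. Then: (i) The elements of $O(n)$ are (pairwise) orthogonal with respect to $\langle\,,\rangle$. (ii) Let $0\le k\le\lfloor n/2\rfloor$ and let $(x_k,\ldots,x_{n-k})$ and $(y_k,\ldots,y_{n-k})$ be any two symmetric Jordan chains in $O(n)$ starting at rank $k$ and ending at rank $n-k$. Then $$\frac{\|x_{u+1}\|}{\|x_u\|}=\frac{\|y_{u+1}\|}{\|y_u\|},\qquad k\le u<n-k.$$ (iii) In the notation of part (ii), for $k\le u<n-k$, $$\frac{\|x_{u+1}\|}{\|x_u\|}=\sqrt{(u+1-k)(n-k-u)}=(n-k-u)\binom{n-2k}{u-k}^{1/2}\binom{n-2k}{u+1-k}^{-1/2}.$$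
   Context: Posets. $M(n,k_1,\ldots,k_n)=\{(x_1,\ldots,x_n)\in\mathbb{N}^n : 0\le x_i\le k_i \text{ for all } i\}$ (with $0\in\mathbb{N}$), partially ordered componentwise, with rank function $r(x_1,\ldots,x_n)=x_1+\cdots+x_n$. The Boolean algebra is $B(n)=M(n,1,\ldots,1)$ (equivalently, subsets of $\{1,\ldots,n\}$ under inclusion), of rank $n$. For a finite set $S$, $V(S)$ is the complex vector space with basis $S$; the standard inner product on $V(B(n))$ is the one for which $\langle X,Y\rangle=\delta(X,Y)$ (Kronecker delta) for $X,Y\in B(n)$. For a graded poset $P$, $P_i$ is the set of elements of rank $i$, and $v\in V(P)$ is homogeneous of rank $r(v)=i$ if $v\in V(P_i)$. The up operator $U:V(P)\to V(P)$ is the linear map with $U(p)=\sum_q q$, the sum over all $q$ covering $p$. Jordan chains. A graded Jordan chain is a sequence $(v_1,\ldots,v_h)$ of nonzero homogeneous vectors of $V(P)$ with $U(v_{i-1})=v_i$ for $2\le i\le h$ and $U(v_h)=0$; it starts at rank $r(v_1)$ and ends at rank $r(v_h)$. It is symmetric if $r(v_1)+r(v_h)$ equals the rank of $P$. A symmetric Jordan basis (SJB) is a basis of $V(P)$ that is a disjoint union of symmetric Jordan chains. In a chain $(x_k,\ldots,x_{n-k})$ the index denotes the rank. The linear BTK algorithm. Step A (two factors). For integers $p,q\ge 0$ define recursively a collection $\mathcal{J}(p,q)$ of sequences of vectors of $V(M(2,p,q))$. If $p=0$ or $q=0$, then $\mathcal{J}(p,q)$ consists of the single sequence listing the elements of the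 chain $M(2,p,q)$ in increasing order. If $p,q\ge 1$, then $\mathcal{J}(p,q)$ consists of: (1) the sequence $(v(0),v(1),\ldots,v(p+q))$, where $v(k)=\sum\binom{k}{i}(i,j)$, the sum over all $0\le i\le p$, $0\le j\le q$ with $i+j=k$; and (2) for each sequence $(w_1,\ldots,w_h)$ in $\mathcal{J}(p-1,q-1)$, the sequence $(\theta(w_1),\ldots,\theta(w_h))$, where $\theta:V(M(2,p-1,q-1))\to V(M(2,p,q))$ is the linear map with $\theta((i,j))=v(i,j+1)$, and $v(i,j)=(p-i)\,(i,j)-(q-j+1)\,(i+1,j-1)$ for $0\le i\le p-1$, $1\le j\le q$. Step B (general case, recursion on $n$). For $n=1$, $\mathcal{L}(k_1)$ consists of the single sequence $(0,1,\ldots,k_1)$ of elements of $M(1,k_1)$. For $n\ge 2$, let the sequences in $\mathcal{L}(k_1,\ldots,k_{n-1})$ be $(v(0,m),\ldots,v(l_m,m))$, $1\le m\le t$. For $0\le j\le k_n$ let $v(i,j,m)\in V(M(n,k_1,\ldots,k_n))$ be the image of $v(i,m)$ under the linear map with $(a_1,\ldots,a_{n-1})\mapsto(a_1,\ldots,a_{n-1},j)$. For each $m$ let $\psi_m:V(M(2,l_m,k_n))\to V(M(n,k_1,\ldots,k_n))$ be the linear map with $\psi_m((i,j))=v(i,j,m)$. Then $\mathcal{L}(k_1,\ldots,k_n)$ consists of all sequences $(\psi_m(w_1),\ldots,\psi_m(w_h))$ with $1\le m\le t$ and $(w_1,\ldots,w_h)\in\mathcal{J}(l_m,k_n)$. The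 sequences in $\mathcal{L}(k_1,\ldots,k_n)$ are symmetric Jordan chains and together form an SJB of $V(M(n,k_1,\ldots,k_n))$. $O(n)$ denotes this SJB in the case $k_1=\cdots=k_n=1$; "a symmetric Jordan chain in $O(n)$" means one of the sequences in $\mathcal{L}(1,\ldots,1)$ ($n$ ones). *)

theory Defs
  imports Complex_Main
begin

text \<open>The tuples of \<open>M(n, k\<^sub>1, \<dots>, k\<^sub>n)\<close> are lists of length \<open>n\<close>; the bounds
  \<open>k\<^sub>1, \<dots>, k\<^sub>n\<close> are the list argument, whose length is \<open>n\<close>.\<close>

definition M :: "nat list \<Rightarrow> nat list set" where
  "M ks = {x. length x = length ks \<and> (\<forall>i<length ks. x ! i \<le> ks ! i)}"

definition rank :: "nat list \<Rightarrow> nat" where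
  "rank x = sum_list x"

definition level :: "nat list \<Rightarrow> nat \<Rightarrow> nat list set" where
  "level ks r = {x \<in> M ks. rank x = r}"

definition B :: "nat \<Rightarrow> nat list set" where
  "B n = M (replicate n 1)"


text \<open>The complex vector space with basis a finite set \<open>S\<close> is rendered by coefficient
  functions vanishing outside \<open>S\<close>.\<close>

definition V :: "'a set \<Rightarrow> ('a \<Rightarrow> complex) set" where
  "V S = {v. \<forall>x. x \<notin> S \<longrightarrow> v x = 0}"

definition bvec :: "'a \<Rightarrow> 'a \<Rightarrow> complex" where
  "bvec x = (\<lambda>y. if y = x then 1 else 0)"

text \<open>\<open>lin S g\<close> is the linear map on \<open>V S\<close> sending each basis element \<open>x \<in> S\<close> to \<open>g x\<close>.\<close>

definition lin :: "'a set \<Rightarrow> ('a \<Rightarrow> 'b \<Rightarrow> complex) \<Rightarrow> ('a \<Rightarrow> complex) \<Rightarrow> 'b \<Rightarrow> complex" where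
  "lin S g v = (\<lambda>y. \<Sum>x\<in>S. v x * g x y)"

definition homogeneous :: "nat list \<Rightarrow> nat \<Rightarrow> (nat list \<Rightarrow> complex) \<Rightarrow> bool" where
  "homogeneous ks r v \<longleftrightarrow> v \<in> V (level ks r)"

definition inner_on :: "'a set \<Rightarrow> ('a \<Rightarrow> complex) \<Rightarrow> ('a \<Rightarrow> complex) \<Rightarrow> complex" where
  "inner_on S v w = (\<Sum>x\<in>S. v x * cnj (w x))"

text \<open>\<open>Re\<close> only changes the type: \<open>inner_on S v v\<close> is a nonnegative real.\<close>

definition norm_on :: "'a set \<Rightarrow> ('a \<Rightarrow> complex) \<Rightarrow> real" where
  "norm_on S v = sqrt (Re (inner_on S v v))"


text \<open>The vectors \<open>v(k)\<close> and \<open>v(i,j)\<close> of \<open>V(M(2,p,q))\<close>. The natural-number subtractions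
  in \<open>diff_vec\<close> are exact in the range \<open>i < p\<close>, \<open>1 \<le> j \<le> q\<close> in which it is used.\<close>

definition diag_vec :: "nat \<Rightarrow> nat \<Rightarrow> nat \<Rightarrow> nat list \<Rightarrow> complex" where
  "diag_vec p q k = (\<lambda>y. \<Sum>x\<in>level [p, q] k. of_nat (k choose (x ! 0)) * bvec x y)"

definition diff_vec :: "nat \<Rightarrow> nat \<Rightarrow> nat \<Rightarrow> nat \<Rightarrow> nat list \<Rightarrow> complex" where
  "diff_vec p q i j =
     (\<lambda>y. of_nat (p - i) * bvec [i, j] y - of_nat (q - j + 1) * bvec [i + 1, j - 1] y)"

definition theta :: "nat \<Rightarrow> nat \<Rightarrow> (nat list \<Rightarrow> complex) \<Rightarrow> nat list \<Rightarrow> complex" where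
  "theta p q = lin (M [p - 1, q - 1]) (\<lambda>x. diff_vec p q (x ! 0) (x ! 1 + 1))"

fun J :: "nat \<Rightarrow> nat \<Rightarrow> (nat list \<Rightarrow> complex) list set" where
  "J 0 q = {map (\<lambda>j. bvec [0, j]) [0..<q + 1]}"
| "J (Suc p) 0 = {map (\<lambda>i. bvec [i, 0]) [0..<Suc p + 1]}"
| "J (Suc p) (Suc q) =
     {map (diag_vec (Suc p) (Suc q)) [0..<Suc p + Suc q + 1]} \<union>
     map (theta (Suc p) (Suc q)) ` J p q"


text \<open>\<open>append_coord ks j\<close> is the linear map
  \<open>(a\<^sub>1, \<dots>, a\<^sub>n\<^sub>-\<^sub>1) \<mapsto> (a\<^sub>1, \<dots>, a\<^sub>n\<^sub>-\<^sub>1, j)\<close>, and \<open>psi ks k c\<close> is the map \<open>\<psi>\<^sub>m\<close> belonging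
  to the chain \<open>c = (v(0,m), \<dots>, v(l\<^sub>m,m))\<close>, so \<open>l\<^sub>m = length c - 1\<close>.\<close>

definition append_coord ::
    "nat list \<Rightarrow> nat \<Rightarrow> (nat list \<Rightarrow> complex) \<Rightarrow> nat list \<Rightarrow> complex" where
  "append_coord ks j = lin (M ks) (\<lambda>a. bvec (a @ [j]))"

definition psi ::
    "nat list \<Rightarrow> nat \<Rightarrow> (nat list \<Rightarrow> complex) list \<Rightarrow> (nat list \<Rightarrow> complex) \<Rightarrow> nat list \<Rightarrow> complex" where
  "psi ks k c = lin (M [length c - 1, k]) (\<lambda>x. append_coord ks (x ! 1) (c ! (x ! 0)))"

text \<open>The recursion splits off the last bound. The value at \<open>[]\<close> is a dummy: the
  construction starts at \<open>n = 1\<close>.\<close>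

fun L :: "nat list \<Rightarrow> (nat list \<Rightarrow> complex) list set" where
  "L [] = {}"
| "L [k] = {map (\<lambda>i. bvec [i]) [0..<k + 1]}"
| "L (k # k' # ks) =
     (let ms = butlast (k # k' # ks); m = last (k # k' # ks) in
      \<Union>c\<in>L ms. map (psi ms m c) ` J (length c - 1) m)"


text \<open>The basis \<open>O(n)\<close>, as the set of sequences it consists of and as its set of vectors.\<close>

definition O_chains :: "nat \<Rightarrow> (nat list \<Rightarrow> complex) list set" where
  "O_chains n = L (replicate n 1)"

definition O_basis :: "nat \<Rightarrow> (nat list \<Rightarrow> complex) set" where
  "O_basis n = (\<Union>c\<in>O_chains n. set c)"

definition O_chains_from :: "nat \<Rightarrow> nat \<Rightarrow> (nat list \<Rightarrow> complex) list set" where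
  "O_chains_from n k =
     {c \<in> O_chains n. homogeneous (replicate n 1) k (hd c) \<and>
                      homogeneous (replicate n 1) (n - k) (last c)}"

text \<open>The vector \<open>x\<^sub>u\<close> of a chain \<open>(x\<^sub>k, \<dots>, x\<^sub>n\<^sub>-\<^sub>k)\<close>, whose indices are ranks.\<close>

definition at_rank :: "nat \<Rightarrow> 'v list \<Rightarrow> nat \<Rightarrow> 'v" where
  "at_rank k c u = c ! (u - k)"

end

theory Submission
  imports Defs
begin

text \<open>A chain \<open>c\<^sub>0, \<dots>, c\<^sub>l\<close> of \<open>B(n)\<close> produces in \<open>B(n + 1)\<close> the chain of the vectors
  \<open>c\<^sub>k \<otimes> 0 + k c\<^sub>k\<^sub>-\<^sub>1 \<otimes> 1\<close> (\<open>upper\<close>) and, if \<open>l > 0\<close>, the chain of the vectors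
  \<open>(l - i) c\<^sub>i \<otimes> 1 - c\<^sub>i\<^sub>+\<^sub>1 \<otimes> 0\<close> (\<open>lower\<close>). By induction on \<open>n\<close>, distinct chains are orthogonal and the
  squared norms within a chain grow by the factors \<open>(i + 1) (l - i)\<close>: this recurrence makes
  \<open>upper\<close> and \<open>lower\<close> orthogonal to each other and passes to both of them.
  It fixes the norm ratios because a chain starting at rank \<open>k\<close> has \<open>l = n - 2 k\<close>.\<close>

section \<open>Sums over products of chains; inner products of coefficient functions\<close>

lemma M_Nil: "M [] = {[]}"
  by (auto simp: M_def)

text \<open>The coordinate split off is the last one, since the recursion of \<open>L\<close> works
  on the last bound.\<close>

lemma M_snoc: "M (ks @ [k]) = (\<lambda>(a, j). a @ [j]) ` (M ks \<times> {..k})"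
proof (intro equalityI subsetI)
  fix x assume x: "x \<in> M (ks @ [k])"
  then have len: "length x = Suc (length ks)" by (simp add: M_def)
  then obtain a j where aj: "x = a @ [j]" by (metis length_Suc_conv_rev)
  with len have la: "length a = length ks" by simp
  have nth: "x ! i \<le> (ks @ [k]) ! i" if "i < Suc (length ks)" for i
    using x that by (simp add: M_def)
  have "j \<le> k" using nth[of "length ks"] aj la by (simp add: nth_append)
  moreover have "a ! i \<le> ks ! i" if "i < length ks" for i
    using nth[of i] that aj la by (simp add: nth_append)
  ultimately show "x \<in> (\<lambda>(a, j). a @ [j]) ` (M ks \<times> {..k})"
    using aj la by (auto simp: M_def)
next
  fix x assume "x \<in> (\<lambda>(a, j). a @ [j]) ` (M ks \<times> {..k})"
  then show "x \<in> M (ks @ [k])"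
    by (auto simp: M_def nth_append less_Suc_eq)
qed

lemma finite_M: "finite (M ks)"
  by (induction ks rule: rev_induct) (auto simp: M_Nil M_snoc)

lemma sum_M_snoc: "sum f (M (ks @ [k])) = (\<Sum>a\<in>M ks. \<Sum>j\<le>k. f (a @ [j]))"
proof -
  have "inj_on (\<lambda>(a, j). a @ [j]) (M ks \<times> {..k})"
    by (auto simp: inj_on_def)
  then show ?thesis
    by (simp add: M_snoc sum.reindex sum.cartesian_product case_prod_unfold)
qed

lemma sum_M_two: "sum f (M [p, q]) = (\<Sum>i\<le>p. \<Sum>j\<le>q. f [i, j])"
  using sum_M_snoc[of f "[p]" q] sum_M_snoc[of "\<lambda>a. \<Sum>j\<le>q. f (a @ [j])" "[]" p]
  by (simp add: M_Nil)

lemma in_M_two: "[i, j] \<in> M [p, q] \<longleftrightarrow> i \<le> p \<and> j \<le> q"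
  by (auto simp: M_def less_Suc_eq)

lemma homogeneous_V: "homogeneous ks r v \<Longrightarrow> v \<in> V (M ks)"
  by (auto simp: homogeneous_def V_def level_def)

text \<open>Sesquilinearity in the form needed for images of two different chains, where every inner
  product on the right is zero.\<close>

lemma inner_on_sum:
  "inner_on S (\<lambda>x. \<Sum>i\<in>I. f i * v i x) (\<lambda>x. \<Sum>j\<in>K. g j * w j x) =
    (\<Sum>i\<in>I. \<Sum>j\<in>K. f i * cnj (g j) * inner_on S (v i) (w j))"
proof -
  have "inner_on S (\<lambda>x. \<Sum>i\<in>I. f i * v i x) (\<lambda>x. \<Sum>j\<in>K. g j * w j x) =
      (\<Sum>x\<in>S. \<Sum>i\<in>I. \<Sum>j\<in>K. f i * cnj (g j) * (v i x * cnj (w j x)))"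
    by (simp add: inner_on_def sum_product cnj_sum mult_ac)
  also have "\<dots> = (\<Sum>i\<in>I. \<Sum>j\<in>K. \<Sum>x\<in>S. f i * cnj (g j) * (v i x * cnj (w j x)))"
    by (subst sum.swap) (rule sum.cong[OF refl sum.swap])
  finally show ?thesis
    by (simp add: inner_on_def sum_distrib_left)
qed

lemma inner_on_scale:
  "inner_on S (\<lambda>x. s * v x) (\<lambda>x. t * w x) = s * cnj t * inner_on S v w"
  by (simp add: inner_on_def sum_distrib_left mult_ac)

lemma inner_on_commute_zero: "inner_on S v w = 0 \<Longrightarrow> inner_on S w v = 0"
proof -
  assume "inner_on S v w = 0"
  moreover have "inner_on S w v = cnj (inner_on S v w)"
    by (simp add: inner_on_def cnj_sum mult.commute)
  ultimately show ?thesis by simp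
qed

text \<open>Being real, the value loses nothing under the \<open>Re\<close> in
  \<open>norm_on\<close>; this carries the complex recurrence for squared norms over to real
  norms.\<close>

lemma inner_on_self: "inner_on S v v = of_real (\<Sum>x\<in>S. (cmod (v x))\<^sup>2)"
  by (simp add: inner_on_def complex_norm_square flip: of_real_power)

text \<open>Different levels are disjoint, so the two vectors have disjoint supports, whatever
  \<open>S\<close> is.\<close>

lemma inner_on_homogeneous:
  assumes "homogeneous ks r v" "homogeneous ks s w" "r \<noteq> s"
  shows "inner_on S v w = 0"
  unfolding inner_on_def
proof (rule sum.neutral, intro ballI)
  fix x
  show "v x * cnj (w x) = 0"
    using assms by (cases "rank x = r") (auto simp: homogeneous_def V_def level_def)
qed

section \<open>Splitting a vector into two layers by the last coordinate\<close>

text \<open>In the notation above, \<open>join v w\<close> is \<open>v \<otimes> 0 + w \<otimes> 1\<close>.\<close>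

definition join :: "(nat list \<Rightarrow> complex) \<Rightarrow> (nat list \<Rightarrow> complex) \<Rightarrow> nat list \<Rightarrow> complex" where
  "join v w y = (if y = [] then 0 else if last y = 0 then v (butlast y)
     else if last y = 1 then w (butlast y) else 0)"

text \<open>The layers with last coordinate 0 and 1 are disjoint, so no mixed terms occur and
  \<open>join\<close> is an orthogonal direct sum.\<close>

lemma inner_on_join:
  "inner_on (M (ks @ [1])) (join v w) (join v' w') = inner_on (M ks) v v' + inner_on (M ks) w w'"
  by (simp add: inner_on_def sum_M_snoc join_def sum.distrib del: One_nat_def)
     (simp add: atMost_Suc sum.distrib add.commute)

text \<open>The appended coordinate 1 adds one to the rank, so the second component must lie one
  rank below the first.\<close>

lemma homogeneous_join:
  assumes "homogeneous ks (Suc r) v" "homogeneous ks r w"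
  shows "homogeneous (ks @ [1]) (Suc r) (join v w)"
  unfolding homogeneous_def V_def
proof (intro CollectI allI impI)
  fix y assume y: "y \<notin> level (ks @ [1]) (Suc r)"
  show "join v w y = 0"
  proof (cases y rule: rev_cases)
    case Nil
    then show ?thesis by (simp add: join_def)
  next
    case (snoc a j)
    then show ?thesis
      using y assms
      by (auto simp: join_def homogeneous_def V_def level_def rank_def M_snoc)
  qed
qed

text \<open>\<open>lin\<close> reads \<open>v\<close> on \<open>M ks\<close> only; membership in
  \<open>V (M ks)\<close> makes the formula right also where \<open>butlast y\<close> lies outside
  \<open>M ks\<close>.\<close>

lemma append_coord_eq:
  assumes "v \<in> V (M ks)"
  shows "append_coord ks j v y = (if y \<noteq> [] \<and> last y = j then v (butlast y) else 0)"
proof (cases y rule: rev_cases)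
  case Nil
  then show ?thesis by (simp add: append_coord_def lin_def bvec_def)
next
  case (snoc b i)
  have "append_coord ks j v y = (\<Sum>a\<in>M ks. if a = b then (if i = j then v b else 0) else 0)"
    unfolding append_coord_def lin_def
    by (rule sum.cong) (auto simp: bvec_def snoc)
  then show ?thesis
    using assms snoc by (auto simp: finite_M V_def)
qed

lemma psi_eq_join:
  assumes "c \<noteq> []" "set c \<subseteq> V (M ks)"
  shows "psi ks 1 c f =
    join (\<lambda>a. \<Sum>i<length c. f [i, 0] * (c ! i) a) (\<lambda>a. \<Sum>i<length c. f [i, 1] * (c ! i) a)"
proof
  fix y
  have idx: "{..length c - 1} = {..<length c}"
    using assms(1) by (cases c) auto
  have ac: "append_coord ks j (c ! i) y =
      (if y \<noteq> [] \<and> last y = j then (c ! i) (butlast y) else 0)" if "i < length c" for i j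
    using assms(2) that by (intro append_coord_eq) (auto dest: nth_mem)
  have "psi ks 1 c f y = (\<Sum>i<length c. f [i, 0] * append_coord ks 0 (c ! i) y
      + f [i, 1] * append_coord ks 1 (c ! i) y)"
    unfolding psi_def lin_def sum_M_two idx by simp
  also have "\<dots> = (\<Sum>i<length c.
      f [i, 0] * (if y \<noteq> [] \<and> last y = 0 then (c ! i) (butlast y) else 0)
      + f [i, 1] * (if y \<noteq> [] \<and> last y = 1 then (c ! i) (butlast y) else 0))"
    by (rule sum.cong) (simp_all add: ac)
  also have "\<dots> = join (\<lambda>a. \<Sum>i<length c. f [i, 0] * (c ! i) a)
      (\<lambda>a. \<Sum>i<length c. f [i, 1] * (c ! i) a) y"
    by (simp add: join_def)
  finally show "psi ks 1 c f y = join (\<lambda>a. \<Sum>i<length c. f [i, 0] * (c ! i) a)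
      (\<lambda>a. \<Sum>i<length c. f [i, 1] * (c ! i) a) y" .
qed

section \<open>The two-factor step with second bound 1\<close>

lemma diag_vec_eq:
  "diag_vec p q k [i, j] = (if i \<le> p \<and> j \<le> q \<and> i + j = k then of_nat (k choose i) else 0)"
proof -
  have fin: "finite (level [p, q] k)"
    by (simp add: level_def finite_M)
  have "diag_vec p q k [i, j] =
      (\<Sum>x\<in>level [p, q] k. if x = [i, j] then of_nat (k choose i) else 0)"
    unfolding diag_vec_def by (rule sum.cong) (auto simp: bvec_def)
  then show ?thesis
    using fin by (auto simp: level_def in_M_two rank_def)
qed

lemma theta_bvec:
  assumes "i < p" "j < q"
  shows "theta p q (bvec [i, j]) = diff_vec p q i (j + 1)"
proof
  fix y
  have "theta p q (bvec [i, j]) y =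
      (\<Sum>x\<in>M [p - 1, q - 1]. if x = [i, j] then diff_vec p q i (j + 1) y else 0)"
    unfolding theta_def lin_def by (rule sum.cong) (auto simp: bvec_def)
  also have "\<dots> = diff_vec p q i (j + 1) y"
    using assms by (auto simp: finite_M in_M_two)
  finally show "theta p q (bvec [i, j]) y = diff_vec p q i (j + 1) y" .
qed

lemma J_zero: "J p 0 = {map (\<lambda>i. bvec [i, 0]) [0..<p + 1]}"
  by (cases p) auto

text \<open>With second bound 1 the recursion ends after one step, because \<open>J p 0\<close> is a
  single chain; hence exactly these two sequences.\<close>

lemma J_one:
  "J (Suc p) 1 = {map (diag_vec (Suc p) 1) [0..<p + 3], map (\<lambda>i. diff_vec (Suc p) 1 i 1) [0..<p + 1]}"
proof -
  have "map (theta (Suc p) 1) (map (\<lambda>i. bvec [i, 0]) [0..<p + 1])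
      = map (\<lambda>i. diff_vec (Suc p) 1 i 1) [0..<p + 1]"
    using theta_bvec[of _ "Suc p" 0 1] by simp
  moreover have "J (Suc p) 1 =
      {map (diag_vec (Suc p) 1) [0..<p + 3]} \<union> map (theta (Suc p) 1) ` J p 0"
    by (simp add: numeral_3_eq_3 del: upt_Suc)
  ultimately show ?thesis
    unfolding J_zero image_insert image_empty by (simp only: insert_is_Un[symmetric])
qed

text \<open>The image of \<open>diag_vec\<close>: the coefficients 1 and \<open>k\<close> are
  \<open>k choose k\<close> and \<open>k choose (k - 1)\<close>. At \<open>k = 0\<close> the
  truncated index \<open>k - 1\<close> is harmless because of the factor 0, and at
  \<open>k = length c\<close> layer 0 is empty.\<close>

definition upper :: "(nat list \<Rightarrow> complex) list \<Rightarrow> nat \<Rightarrow> nat list \<Rightarrow> complex" where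
  "upper c k = join (if k < length c then c ! k else (\<lambda>_. 0)) (\<lambda>a. of_nat k * (c ! (k - 1)) a)"

text \<open>The image of \<open>diff_vec\<close> with \<open>q = j = 1\<close>, where
  \<open>q - j + 1\<close> is 1. The factor \<open>- 1\<close> is written out so that
  \<open>inner_on_scale\<close> applies.\<close>

definition lower :: "(nat list \<Rightarrow> complex) list \<Rightarrow> nat \<Rightarrow> nat list \<Rightarrow> complex" where
  "lower c i = join (\<lambda>a. - 1 * (c ! (i + 1)) a) (\<lambda>a. of_nat (length c - 1 - i) * (c ! i) a)"

lemma psi_diag_vec:
  assumes "c \<noteq> []" "set c \<subseteq> V (M ks)" "k \<le> length c"
  shows "psi ks 1 c (diag_vec (length c - 1) 1 k) = upper c k"
proof -
  have le: "i \<le> length c - 1" if "i < length c" for i using that by simp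
  have "(\<Sum>i<length c. diag_vec (length c - 1) 1 k [i, 0] * (c ! i) a)
      = (\<Sum>i<length c. if i = k then (c ! k) a else 0)" for a
    by (rule sum.cong) (auto simp: diag_vec_eq)
  then have 1: "(\<Sum>i<length c. diag_vec (length c - 1) 1 k [i, 0] * (c ! i) a)
      = (if k < length c then c ! k else (\<lambda>_. 0)) a" for a
    by simp
  have "(\<Sum>i<length c. diag_vec (length c - 1) 1 k [i, 1] * (c ! i) a)
      = (\<Sum>i<length c. if i = k - 1 then of_nat k * (c ! (k - 1)) a else 0)" for a
    by (rule sum.cong) (auto simp: diag_vec_eq)
  moreover have "k - 1 < length c"
    using assms(1,3) by (cases c) auto
  ultimately have 2: "(\<Sum>i<length c. diag_vec (length c - 1) 1 k [i, 1] * (c ! i) a)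
      = of_nat k * (c ! (k - 1)) a" for a
    by simp
  show ?thesis
    unfolding psi_eq_join[OF assms(1,2)] upper_def 1 2 ..
qed

lemma psi_diff_vec:
  assumes "set c \<subseteq> V (M ks)" "i + 1 < length c"
  shows "psi ks 1 c (diff_vec (length c - 1) 1 i 1) = lower c i"
proof -
  have ne: "c \<noteq> []" using assms(2) by auto
  have "(\<Sum>h<length c. diff_vec (length c - 1) 1 i 1 [h, 0] * (c ! h) a)
      = (\<Sum>h<length c. if h = i + 1 then - 1 * (c ! (i + 1)) a else 0)" for a
    by (rule sum.cong) (auto simp: diff_vec_def bvec_def)
  then have 1: "(\<Sum>h<length c. diff_vec (length c - 1) 1 i 1 [h, 0] * (c ! h) a)
      = - 1 * (c ! (i + 1)) a" for a
    using assms(2) by simp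
  have "(\<Sum>h<length c. diff_vec (length c - 1) 1 i 1 [h, 1] * (c ! h) a)
      = (\<Sum>h<length c. if h = i then of_nat (length c - 1 - i) * (c ! i) a else 0)" for a
    by (rule sum.cong) (auto simp: diff_vec_def bvec_def)
  then have 2: "(\<Sum>h<length c. diff_vec (length c - 1) 1 i 1 [h, 1] * (c ! h) a)
      = of_nat (length c - 1 - i) * (c ! i) a" for a
    using assms(2) by simp
  show ?thesis
    unfolding psi_eq_join[OF ne assms(1)] lower_def 1 2 ..
qed

lemma psi_image_J_one:
  assumes "c \<noteq> []" "set c \<subseteq> V (M ks)"
  shows "map (psi ks 1 c) ` J (length c - 1) 1 =
    insert (map (upper c) [0..<length c + 1])
      (if length c = 1 then {} else {map (lower c) [0..<length c - 1]})"
proof (cases "length c = 1")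
  case True
  \<comment> \<open>For a one-vector chain, \<open>J 0 1\<close> consists of basis vectors and
    involves no \<open>diag_vec\<close>; their images are nevertheless \<open>upper c 0\<close> and
    \<open>upper c 1\<close>.\<close>
  have "map (\<lambda>j. bvec [0, j]) [0..<2] = (map (\<lambda>j. bvec [0, j]) [0, 1] :: (nat list \<Rightarrow> complex) list)"
    by (simp add: numeral_2_eq_2)
  then have J: "J 0 1 = {map (\<lambda>j. bvec [0, j]) [0, 1]}"
    by (simp add: numeral_2_eq_2)
  have "psi ks 1 c (bvec [0, j]) = upper c j" if "j \<in> {0, 1}" for j
    unfolding psi_eq_join[OF assms]
    using that True by (auto simp: upper_def bvec_def join_def fun_eq_iff)
  then show ?thesis
    using True J by (simp add: numeral_2_eq_2)
next
  case False
  with assms(1) obtain p where p: "length c = p + 2"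
    by (cases c) (auto simp: neq_Nil_conv)
  have "map (psi ks 1 c) (map (diag_vec (length c - 1) 1) [0..<length c + 1])
      = map (upper c) [0..<length c + 1]"
    using psi_diag_vec[OF assms] by auto
  moreover have "map (psi ks 1 c) (map (\<lambda>i. diff_vec (length c - 1) 1 i 1) [0..<length c - 1])
      = map (lower c) [0..<length c - 1]"
    using psi_diff_vec[OF assms(2)] by auto
  moreover have "J (length c - 1) 1 = {map (diag_vec (length c - 1) 1) [0..<length c + 1],
      map (\<lambda>i. diff_vec (length c - 1) 1 i 1) [0..<length c - 1]}"
    using J_one[of p] p by (simp add: numeral_3_eq_3 del: upt_Suc J.simps)
  ultimately show ?thesis
    by (simp only: image_insert image_empty False if_False)
qed

section \<open>Weight chains and the norms of their descendants\<close>

text \<open>The norms are those that an invariant inner product gives to the weight vectors of the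
  irreducible \<open>sl\<^sub>2\<close>-module of dimension \<open>l + 1\<close>.\<close>

definition weight_chain :: "nat list \<Rightarrow> nat \<Rightarrow> nat \<Rightarrow> (nat list \<Rightarrow> complex) list \<Rightarrow> bool" where
  "weight_chain ks r l c \<longleftrightarrow> length c = l + 1 \<and>
     (\<forall>i\<le>l. homogeneous ks (r + i) (c ! i) \<and> inner_on (M ks) (c ! i) (c ! i) \<noteq> 0) \<and>
     (\<forall>i<l. inner_on (M ks) (c ! (i + 1)) (c ! (i + 1)) =
        of_nat ((i + 1) * (l - i)) * inner_on (M ks) (c ! i) (c ! i))"

lemma weight_chain_orthogonal:
  assumes "weight_chain ks r l c" "i \<le> l" "j \<le> l" "i \<noteq> j"
  shows "inner_on S (c ! i) (c ! j) = 0"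
  using assms by (intro inner_on_homogeneous[of ks "r + i" _ "r + j"]) (auto simp: weight_chain_def)

lemma weight_chain_in_V:
  assumes "weight_chain ks r l c"
  shows "set c \<subseteq> V (M ks)"
proof
  fix v assume "v \<in> set c"
  then obtain i where "i < length c" "v = c ! i"
    by (auto simp: in_set_conv_nth)
  then have "homogeneous ks (r + i) v"
    using assms by (simp add: weight_chain_def)
  then show "v \<in> V (M ks)" by (rule homogeneous_V)
qed

lemma homogeneous_zero: "homogeneous ks r (\<lambda>_. 0)"
  by (simp add: homogeneous_def V_def)

lemma homogeneous_scale: "homogeneous ks r v \<Longrightarrow> homogeneous ks r (\<lambda>a. s * v a)"
  by (simp add: homogeneous_def V_def)

text \<open>The case that \<open>homogeneous_join\<close> cannot express: below rank 0 there is no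
  rank for the second component, which must be zero.\<close>

lemma homogeneous_join_zero:
  assumes "homogeneous ks 0 v"
  shows "homogeneous (ks @ [1]) 0 (join v (\<lambda>_. 0))"
  unfolding homogeneous_def V_def
proof (intro CollectI allI impI)
  fix y assume y: "y \<notin> level (ks @ [1]) 0"
  show "join v (\<lambda>_. 0) y = 0"
    by (cases y rule: rev_cases)
       (use y assms in \<open>auto simp: join_def homogeneous_def V_def level_def rank_def M_snoc\<close>)
qed

text \<open>With \<open>N\<close> for squared norms, the recurrence turns
  \<open>N k + k k N (k - 1)\<close> into \<open>(k (l - k + 1) + k k) N (k - 1)\<close>, and the
  coefficient is \<open>k (l + 1)\<close>. At \<open>k = l + 1\<close> only the second term is left,
  with the same coefficient. At \<open>k = 0\<close> the index \<open>k - 1\<close> is 0 and the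
  norm is that of \<open>c ! 0\<close>.\<close>

lemma norm_upper:
  assumes "weight_chain ks r l c" "k \<le> l + 1"
  shows "inner_on (M (ks @ [1])) (upper c k) (upper c k) =
    (if k = 0 then 1 else of_nat (k * (l + 1))) * inner_on (M ks) (c ! (k - 1)) (c ! (k - 1))"
proof -
  let ?N = "\<lambda>i. inner_on (M ks) (c ! i) (c ! i)"
  have len: "length c = l + 1" using assms(1) by (simp add: weight_chain_def)
  have up: "inner_on (M (ks @ [1])) (upper c k) (upper c k) =
      (if k \<le> l then ?N k else 0) + of_nat k * of_nat k * ?N (k - 1)"
    unfolding upper_def inner_on_join inner_on_scale
    by (simp add: len inner_on_def)
  show ?thesis
  proof (cases k)
    case 0
    then show ?thesis using up by simp
  next
    case (Suc i)
    show ?thesis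
    proof (cases "k \<le> l")
      case True
      then have N: "?N k = of_nat ((i + 1) * (l - i)) * ?N i"
        using assms(1) Suc by (simp add: weight_chain_def)
      have k: "k - 1 = i" using Suc by simp
      \<comment> \<open>Writing \<open>l = Suc i + d\<close> removes the truncated subtraction
        \<open>l - i\<close>, leaving a polynomial identity.\<close>
      obtain d where "l = Suc i + d" using True Suc le_Suc_ex by blast
      then have "k * (l + 1) = (i + 1) * (l - i) + k * k"
        using Suc by (simp add: algebra_simps)
      then have coeff: "of_nat (k * (l + 1)) = (of_nat ((i + 1) * (l - i)) + of_nat k * of_nat k :: complex)"
        by (metis of_nat_add of_nat_mult)
      have "inner_on (M (ks @ [1])) (upper c k) (upper c k) = of_nat (k * (l + 1)) * ?N i"
        unfolding up if_P[OF True] k N coeff by (rule distrib_right[symmetric])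
      then show ?thesis
        unfolding k using Suc by (simp del: of_nat_mult)
    next
      case False
      then have "k = l + 1" using assms(2) by simp
      then show ?thesis using up by (simp add: algebra_simps)
    qed
  qed
qed

text \<open>The two layers contribute \<open>(i + 1) (l - i)\<close> and
  \<open>(l - i) (l - i)\<close> times the squared norm of \<open>c ! i\<close>, the first by the
  recurrence.\<close>

lemma norm_lower:
  assumes "weight_chain ks r l c" "i < l"
  shows "inner_on (M (ks @ [1])) (lower c i) (lower c i) =
    of_nat ((l - i) * (l + 1)) * inner_on (M ks) (c ! i) (c ! i)"
proof -
  have len: "length c = l + 1" using assms(1) by (simp add: weight_chain_def)
  have "inner_on (M ks) (c ! (i + 1)) (c ! (i + 1)) =
      of_nat ((i + 1) * (l - i)) * inner_on (M ks) (c ! i) (c ! i)"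
    using assms by (simp add: weight_chain_def)
  then have "inner_on (M (ks @ [1])) (lower c i) (lower c i) =
      of_nat ((i + 1) * (l - i) + (l - i) * (l - i)) * inner_on (M ks) (c ! i) (c ! i)"
    unfolding lower_def inner_on_join inner_on_scale
    by (simp add: len distrib_right)
  also have "(i + 1) * (l - i) + (l - i) * (l - i) = (l - i) * (l + 1)"
    using assms(2) by (auto simp: algebra_simps less_iff_Suc_add)
  finally show ?thesis .
qed

text \<open>Unless \<open>k = i + 1\<close>, both layers vanish by rank. For
  \<open>k = i + 1\<close> the layers give \<open>(i + 1) (l - i)\<close> times the squared norm of
  \<open>c ! i\<close> with opposite signs, layer 0 by the recurrence.\<close>

lemma upper_lower_orthogonal:
  assumes "weight_chain ks r l c" "k \<le> l + 1" "i < l"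
  shows "inner_on (M (ks @ [1])) (upper c k) (lower c i) = 0"
proof -
  have len: "length c = l + 1" using assms(1) by (simp add: weight_chain_def)
  let ?e = "if k < length c then c ! k else (\<lambda>_. 0)"
  have eq: "inner_on (M (ks @ [1])) (upper c k) (lower c i) =
      - inner_on (M ks) ?e (c ! (i + 1))
      + of_nat k * of_nat (l - i) * inner_on (M ks) (c ! (k - 1)) (c ! i)"
    unfolding upper_def lower_def inner_on_join inner_on_scale
    using inner_on_scale[of "M ks" 1 ?e "- 1" "c ! (i + 1)"] by (simp add: len)
  show ?thesis
  proof (cases "k = i + 1")
    case True
    then have k: "k - 1 = i" and e: "?e = c ! (i + 1)"
      using assms(3) by (simp_all add: len)
    have N: "inner_on (M ks) (c ! (i + 1)) (c ! (i + 1)) =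
        of_nat ((i + 1) * (l - i)) * inner_on (M ks) (c ! i) (c ! i)"
      using assms(1,3) by (simp add: weight_chain_def)
    show ?thesis
      unfolding eq e k N unfolding True of_nat_mult by (rule add.left_inverse)
  next
    case False
    have "inner_on (M ks) ?e (c ! (i + 1)) = 0"
      using weight_chain_orthogonal[OF assms(1), of k "i + 1"] False assms
      by (auto simp: len inner_on_def)
    \<comment> \<open>The factor \<open>of_nat k\<close> belongs to the claim: for
      \<open>k = 0\<close> the index \<open>k - 1\<close> is 0 and may equal
      \<open>i\<close>.\<close>
    moreover have "of_nat k * inner_on (M ks) (c ! (k - 1)) (c ! i) = 0"
      using weight_chain_orthogonal[OF assms(1), of "k - 1" i] False assms
      by (cases "k = 0") auto
    ultimately show ?thesis
      using eq by auto
  qed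
qed

text \<open>By \<open>norm_upper\<close>, for \<open>i > 0\<close> the new growth factor is
  \<open>(i + 1) / i\<close> times the old factor \<open>i (l - i + 1)\<close>, that is
  \<open>(i + 1) (l + 1 - i)\<close>. The index \<open>i = 0\<close> is separate because of the
  special coefficient 1.\<close>

lemma weight_chain_upper:
  assumes "weight_chain ks r l c"
  shows "weight_chain (ks @ [1]) r (l + 1) (map (upper c) [0..<length c + 1])"
proof -
  let ?d = "map (upper c) [0..<length c + 1]"
  have len: "length c = l + 1" using assms by (simp add: weight_chain_def)
  have nth: "?d ! k = upper c k" if "k \<le> l + 1" for k
    using that by (simp add: len del: upt_Suc)
  have hom: "homogeneous (ks @ [1]) (r + k) (upper c k)" if k: "k \<le> l + 1" for k
  proof -
    have 1: "homogeneous ks (r + k) (if k < length c then c ! k else (\<lambda>_. 0))"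
      using assms by (simp add: weight_chain_def homogeneous_zero)
    show ?thesis
    proof (cases k)
      case 0
      have "homogeneous (ks @ [1]) r (join (c ! 0) (\<lambda>_. 0))"
      \<comment> \<open>The zero second component would have rank \<open>r - 1\<close>, which exists
        only for \<open>r > 0\<close>.\<close>
      proof (cases r)
        case 0
        then show ?thesis using assms
          by (metis homogeneous_join_zero weight_chain_def add.right_neutral zero_le)
      next
        case (Suc s)
        then show ?thesis
          using homogeneous_join[of ks s "c ! 0" "\<lambda>_. 0"] 1 0 len by (simp add: homogeneous_zero)
      qed
      then show ?thesis using 0 len by (simp add: upper_def)
    next
      case (Suc i)
      have "homogeneous ks (r + i) (\<lambda>a. of_nat k * (c ! (k - 1)) a)"
        using assms k Suc by (intro homogeneous_scale) (simp add: weight_chain_def)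
      then have "homogeneous (ks @ [1]) (Suc (r + i)) (upper c k)"
        unfolding upper_def using 1 Suc by (intro homogeneous_join) simp_all
      then show ?thesis using Suc by simp
    qed
  qed
  have ne: "inner_on (M (ks @ [1])) (upper c k) (upper c k) \<noteq> 0" if "k \<le> l + 1" for k
    using assms that norm_upper[OF assms that]
    by (auto simp: weight_chain_def simp del: of_nat_mult of_nat_add)
  have step: "inner_on (M (ks @ [1])) (upper c (i + 1)) (upper c (i + 1)) =
      of_nat ((i + 1) * (l + 1 - i)) * inner_on (M (ks @ [1])) (upper c i) (upper c i)"
    if i: "i < l + 1" for i
  proof (cases i)
    case 0
    then show ?thesis
      using norm_upper[OF assms, of 0] norm_upper[OF assms, of 1] by simp
  next
    case (Suc h)
    then have N: "inner_on (M ks) (c ! i) (c ! i) =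
        of_nat ((h + 1) * (l - h)) * inner_on (M ks) (c ! h) (c ! h)"
      using assms i by (simp add: weight_chain_def)
    have U: "inner_on (M (ks @ [1])) (upper c i) (upper c i) =
          of_nat (i * (l + 1)) * inner_on (M ks) (c ! h) (c ! h)"
        "inner_on (M (ks @ [1])) (upper c (i + 1)) (upper c (i + 1)) =
          of_nat ((i + 1) * (l + 1)) * inner_on (M ks) (c ! i) (c ! i)"
      using norm_upper[OF assms, of i] norm_upper[OF assms, of "i + 1"] i Suc by simp_all
    have "(i + 1) * (l + 1) * ((h + 1) * (l - h)) = (i + 1) * (l + 1 - i) * (i * (l + 1))"
    proof -
      have "h + 1 = i" "l - h = l + 1 - i" using Suc by simp_all
      then show ?thesis by (simp only: mult_ac)
    qed
    then show ?thesis
      unfolding U N by (metis mult.assoc of_nat_mult)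
  qed
  show ?thesis
    unfolding weight_chain_def
    using nth hom ne step by (simp add: len del: upt_Suc)
qed

text \<open>By \<open>norm_lower\<close> the growth factor \<open>(i + 1) (Suc l - i)\<close> of
  \<open>c\<close> is multiplied by \<open>(l - i) / (Suc l - i)\<close>. The chain loses its old
  bottom rank, hence the start at \<open>r + 1\<close>.\<close>

lemma weight_chain_lower:
  assumes "weight_chain ks r (Suc l) c"
  shows "weight_chain (ks @ [1]) (r + 1) l (map (lower c) [0..<length c - 1])"
proof -
  let ?d = "map (lower c) [0..<length c - 1]"
  have len: "length c = l + 2" using assms by (simp add: weight_chain_def)
  have nth: "?d ! k = lower c k" if "k \<le> l" for k
    using that by (simp add: len del: upt_Suc)
  have hom: "homogeneous (ks @ [1]) (r + 1 + i) (lower c i)" if i: "i \<le> l" for i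
  proof -
    have "homogeneous ks (Suc (r + i)) (\<lambda>a. - 1 * (c ! (i + 1)) a)"
      "homogeneous ks (r + i) (\<lambda>a. of_nat (length c - 1 - i) * (c ! i) a)"
      using assms i by (intro homogeneous_scale; force simp: weight_chain_def)+
    then show ?thesis
      unfolding lower_def using homogeneous_join by simp
  qed
  have ne: "inner_on (M (ks @ [1])) (lower c i) (lower c i) \<noteq> 0" if "i \<le> l" for i
  proof -
    have "i < Suc l" using that by simp
    then show ?thesis
      using assms unfolding norm_lower[OF assms \<open>i < Suc l\<close>] mult_eq_0_iff of_nat_eq_0_iff
      by (simp add: weight_chain_def)
  qed
  have step: "inner_on (M (ks @ [1])) (lower c (i + 1)) (lower c (i + 1)) =
      of_nat ((i + 1) * (l - i)) * inner_on (M (ks @ [1])) (lower c i) (lower c i)"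
    if i: "i < l" for i
  proof -
    have N: "inner_on (M ks) (c ! (i + 1)) (c ! (i + 1)) =
        of_nat ((i + 1) * (Suc l - i)) * inner_on (M ks) (c ! i) (c ! i)"
      using assms i by (simp add: weight_chain_def)
    have less: "i < Suc l" "i + 1 < Suc l" using i by simp_all
    have "(Suc l - (i + 1)) * (Suc l + 1) * ((i + 1) * (Suc l - i)) =
        (i + 1) * (l - i) * ((Suc l - i) * (Suc l + 1))"
    proof -
      have "Suc l - (i + 1) = l - i" by simp
      then show ?thesis by (simp only: mult_ac)
    qed
    then show ?thesis
      unfolding norm_lower[OF assms less(1)] norm_lower[OF assms less(2)] N
      by (metis mult.assoc of_nat_mult)
  qed
  show ?thesis
    unfolding weight_chain_def
    using nth hom ne step by (simp add: len del: upt_Suc)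
qed

section \<open>Orthogonality between chains and the induction on n\<close>

definition orthogonal_chains ::
    "nat list \<Rightarrow> (nat list \<Rightarrow> complex) list \<Rightarrow> (nat list \<Rightarrow> complex) list \<Rightarrow> bool" where
  "orthogonal_chains ks c d \<longleftrightarrow> (\<forall>v\<in>set c. \<forall>w\<in>set d. inner_on (M ks) v w = 0)"

lemma orthogonal_chains_commute: "orthogonal_chains ks c d \<Longrightarrow> orthogonal_chains ks d c"
  by (auto simp: orthogonal_chains_def intro: inner_on_commute_zero)

text \<open>\<open>psi ks 1 c\<close> maps everything into the span of the vectors of
  \<open>c\<close> placed in the two layers, and these spans are orthogonal for \<open>c\<close> and
  \<open>d\<close>. So \<open>e\<close> and \<open>e'\<close> can be arbitrary.\<close>

lemma orthogonal_chains_psi: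
  assumes "orthogonal_chains ks c d" "c \<noteq> []" "d \<noteq> []"
    "set c \<subseteq> V (M ks)" "set d \<subseteq> V (M ks)"
  shows "orthogonal_chains (ks @ [1]) (map (psi ks 1 c) e) (map (psi ks 1 d) e')"
proof -
  have 0: "inner_on (M ks) (c ! i) (d ! j) = 0" if "i < length c" "j < length d" for i j
    using assms(1) that by (simp add: orthogonal_chains_def)
  have "inner_on (M (ks @ [1])) (psi ks 1 c f) (psi ks 1 d g) = 0" for f g
    unfolding psi_eq_join[OF assms(2,4)] psi_eq_join[OF assms(3,5)] inner_on_join inner_on_sum
    by (simp add: 0)
  then show ?thesis
    by (simp add: orthogonal_chains_def)
qed

lemma L_snoc:
  assumes "ks \<noteq> []"
  shows "L (ks @ [k]) = (\<Union>c\<in>L ks. map (psi ks k c) ` J (length c - 1) k)"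
proof -
  obtain a as where ks: "ks = a # as" using assms by (cases ks) simp_all
  obtain b bs where bs: "as @ [k] = b # bs" by (cases "as @ [k]") simp_all
  have "a # b # bs = ks @ [k]" by (simp add: ks bs)
  with L.simps(3)[of a b bs] show ?thesis
    by (simp only: Let_def butlast_snoc last_snoc)
qed

lemma weight_chain_singleton: "weight_chain [1] 0 1 (map (\<lambda>i. bvec [i]) [0..<1 + 1])"
proof -
  have "inner_on (M [1]) (bvec [i]) (bvec [i]) = 1" if "i \<le> 1" for i
    using that sum_M_snoc[of "\<lambda>x. bvec [i] x * cnj (bvec [i] x)" "[]" 1]
    by (auto simp: inner_on_def M_Nil bvec_def le_Suc_eq)
  moreover have "homogeneous [1] i (bvec [i])" if "i \<le> 1" for i
    using that by (auto simp: homogeneous_def V_def level_def bvec_def rank_def M_def)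
  ultimately show ?thesis
    by (auto simp: weight_chain_def le_Suc_eq)
qed

text \<open>The equation \<open>l + 2 * r = n\<close> is the symmetry of the chain, whose end ranks
  are \<open>r\<close> and \<open>r + l\<close>. Passing to \<open>(r, l + 1)\<close> or to
  \<open>(r + 1, l - 1)\<close> raises \<open>l + 2 * r\<close> by one. Orthogonality needs the
  weight recurrence, so both claims share one induction.\<close>

lemma L_ones_orthogonal_weight_chains:
  assumes "n \<ge> 1"
  shows "(\<forall>c\<in>L (replicate n 1). \<exists>r l. l + 2 * r = n \<and> weight_chain (replicate n 1) r l c) \<and>
    pairwise (orthogonal_chains (replicate n 1)) (L (replicate n 1))"
  using assms
proof (induction n rule: nat_induct_at_least)
  case base
  have "L [1] = {map (\<lambda>i. bvec [i]) [0..<1 + 1]}" by simp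
  moreover have "1 + 2 * 0 = (1::nat)" by simp
  ultimately show ?case
    using weight_chain_singleton
    by (simp only: replicate_0 replicate_Suc One_nat_def pairwise_singleton) blast
next
  case (Suc n)
  define ks where "ks = replicate n (1 :: nat)"
  have rep: "replicate (Suc n) 1 = ks @ [1]"
    by (simp add: ks_def replicate_append_same)
  have "ks \<noteq> []" using Suc.hyps by (simp add: ks_def)
  note L = L_snoc[OF this, of 1]
  have IH1: "\<exists>r l. l + 2 * r = n \<and> weight_chain ks r l c" if "c \<in> L ks" for c
    using Suc.IH that by (simp add: ks_def)
  have IH2: "orthogonal_chains ks c d" if "c \<in> L ks" "d \<in> L ks" "c \<noteq> d" for c d
    using Suc.IH that by (simp add: ks_def pairwise_def)
  have chain: "c \<noteq> []" "set c \<subseteq> V (M ks)" if "c \<in> L ks" for c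
  proof -
    show "c \<noteq> []" using IH1[OF that] by (auto simp: weight_chain_def)
    show "set c \<subseteq> V (M ks)" using IH1[OF that] weight_chain_in_V by blast
  qed
  note img = psi_image_J_one[OF chain]
  show ?case
    unfolding rep
  proof (intro conjI ballI pairwiseI)
    fix d assume "d \<in> L (ks @ [1])"
    then obtain c where c: "c \<in> L ks" "d \<in> map (psi ks 1 c) ` J (length c - 1) 1"
      unfolding L by blast
    obtain r l where rl: "l + 2 * r = n" "weight_chain ks r l c"
      using IH1[OF c(1)] by blast
    then have len: "length c = l + 1" by (simp add: weight_chain_def)
    from c(2) consider "d = map (upper c) [0..<length c + 1]"
      | h where "l = Suc h" "d = map (lower c) [0..<length c - 1]"
      unfolding img[OF c(1) c(1)] unfolding len by (cases l) (auto simp del: upt_Suc)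
    then show "\<exists>r l. l + 2 * r = Suc n \<and> weight_chain (ks @ [1]) r l d"
    proof cases
      case 1
      moreover have "l + 1 + 2 * r = Suc n" using rl(1) by simp
      ultimately show ?thesis
        using weight_chain_upper[OF rl(2)] by blast
    next
      case 2
      moreover have "h + 2 * (r + 1) = Suc n" using rl(1) 2(1) by simp
      ultimately show ?thesis
        using weight_chain_lower[of ks r h c] rl(2) by blast
    qed
  next
    fix d d' assume "d \<in> L (ks @ [1])" "d' \<in> L (ks @ [1])" and ne: "d \<noteq> d'"
    then obtain c c' where c: "c \<in> L ks" "d \<in> map (psi ks 1 c) ` J (length c - 1) 1"
      and c': "c' \<in> L ks" "d' \<in> map (psi ks 1 c') ` J (length c' - 1) 1"
      unfolding L by blast
    show "orthogonal_chains (ks @ [1]) d d'"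
    proof (cases "c = c'")
      case False
      then have "orthogonal_chains ks c c'" using IH2 c(1) c'(1) by blast
      moreover obtain e e' where "d = map (psi ks 1 c) e" "d' = map (psi ks 1 c') e'"
        using c(2) c'(2) by blast
      ultimately show ?thesis
        using orthogonal_chains_psi chain[OF c(1)] chain[OF c'(1)] by blast
    next
      case True
      obtain r l where rl: "weight_chain ks r l c"
        using IH1[OF c(1)] by blast
      then have len: "length c = l + 1" by (simp add: weight_chain_def)
      \<comment> \<open>Distinct chains with the same parent \<open>c\<close> can only be its
        \<open>upper\<close> and its \<open>lower\<close> chain.\<close>
      have "orthogonal_chains (ks @ [1]) (map (upper c) [0..<length c + 1])
          (map (lower c) [0..<length c - 1])"
        using upper_lower_orthogonal[OF rl]
        by (auto simp: orthogonal_chains_def len simp del: upt_Suc)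
      then show ?thesis
        using c(2) c'(2) ne orthogonal_chains_commute
        unfolding True[symmetric] img[OF c(1) c(1)] by (auto split: if_splits simp del: upt_Suc)
    qed
  qed
qed

section \<open>Orthogonality of the basis and the norm ratios\<close>

lemma O_basis_orthogonal:
  assumes "n \<ge> 1"
  shows "pairwise (\<lambda>v w. inner_on (B n) v w = 0) (O_basis n)"
proof (intro pairwiseI)
  fix v w assume "v \<in> O_basis n" "w \<in> O_basis n" and ne: "v \<noteq> w"
  then obtain c d where cd: "c \<in> O_chains n" "v \<in> set c" "d \<in> O_chains n" "w \<in> set d"
    by (auto simp: O_basis_def)
  show "inner_on (B n) v w = 0"
  proof (cases "c = d")
    case True
    obtain r l where rl: "weight_chain (replicate n 1) r l c"
      using L_ones_orthogonal_weight_chains[OF assms] cd by (auto simp: O_chains_def)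
    moreover obtain i j where "v = c ! i" "w = c ! j" "i < length c" "j < length c"
      using cd True by (auto simp: in_set_conv_nth)
    ultimately show ?thesis
      using ne weight_chain_orthogonal[OF rl, of i j] by (auto simp: weight_chain_def)
  next
    case False
    then have "orthogonal_chains (replicate n 1) c d"
      using L_ones_orthogonal_weight_chains[OF assms] cd by (simp add: O_chains_def pairwise_def)
    then show ?thesis
      using cd by (simp add: orthogonal_chains_def B_def)
  qed
qed

text \<open>The starting rank \<open>k\<close> determines \<open>l = n - 2 k\<close>, and with it
  all growth factors. The value does not mention the chain, so equality of the ratios of two chains
  follows too.\<close>

lemma O_chains_from_norm_ratio:
  assumes "n \<ge> 1" "x \<in> O_chains_from n k" "k \<le> u" "u < n - k"
  shows "norm_on (B n) (at_rank k x (u + 1)) / norm_on (B n) (at_rank k x u) =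
    sqrt (real ((u + 1 - k) * (n - k - u)))"
proof -
  let ?ks = "replicate n (1 :: nat)"
  have x: "x \<in> L ?ks" "homogeneous ?ks k (hd x)"
    using assms(2) by (auto simp: O_chains_from_def O_chains_def)
  then obtain r l where rl: "l + 2 * r = n" "weight_chain ?ks r l x"
    using L_ones_orthogonal_weight_chains[OF assms(1)] by blast
  have hd: "hd x = x ! 0"
    using rl(2) by (cases x) (auto simp: weight_chain_def)
  have "homogeneous ?ks (r + 0) (x ! 0)" "inner_on (M ?ks) (x ! 0) (x ! 0) \<noteq> 0"
    using rl(2) unfolding weight_chain_def by blast+
  \<comment> \<open>A nonzero vector cannot be homogeneous of two ranks, as it would be orthogonal
    to itself.\<close>
  then have r: "r = k"
    using inner_on_homogeneous[of ?ks "r + 0" "x ! 0" k "x ! 0" "M ?ks"] x(2) hd by auto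
  define a where "a = u - k"
  have a: "a < l" "u + 1 - k = a + 1" "n - k - u = l - a"
    using assms(3,4) rl(1) r by (auto simp: a_def)
  have "inner_on (B n) (x ! (a + 1)) (x ! (a + 1)) =
      of_nat ((a + 1) * (l - a)) * inner_on (B n) (x ! a) (x ! a)"
    using rl(2) a(1) by (simp add: weight_chain_def B_def)
  then have "norm_on (B n) (x ! (a + 1)) =
      sqrt (real ((a + 1) * (l - a))) * norm_on (B n) (x ! a)"
    by (simp add: norm_on_def inner_on_self flip: real_sqrt_mult of_real_mult of_nat_mult)
  \<comment> \<open>Needed to cancel the denominator, since division by zero yields 0.\<close>
  moreover have "norm_on (B n) (x ! a) \<noteq> 0"
  proof -
    have "inner_on (B n) (x ! a) (x ! a) \<noteq> 0"
      using rl(2) a(1) by (simp add: weight_chain_def B_def)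
    then show ?thesis
      by (simp only: norm_on_def inner_on_self of_real_eq_0_iff Re_complex_of_real
          real_sqrt_eq_zero_cancel_iff not_False_eq_True)
  qed
  ultimately show ?thesis
    unfolding at_rank_def a(2,3) a_def[symmetric] by simp
qed

text \<open>Absorption on both sides gives
  \<open>(a + 1) (m choose (a + 1)) = (m - a) (m choose a)\<close>. Solving for \<open>a + 1\<close>
  makes the radicand \<open>(m - a)\<close> squared times a quotient of binomial
  coefficients.\<close>

lemma sqrt_binomial_ratio:
  assumes "a < m"
  shows "sqrt (real ((a + 1) * (m - a))) =
    real (m - a) * real (m choose a) powr (1 / 2) * real (m choose (a + 1)) powr (- 1 / 2)"
proof -
  have "(a + 1) * (m choose (a + 1)) = (m - a) * (m choose a)"
    using binomial_absorb_comp[of m a] binomial_absorption[of a m] by simp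
  then have eq: "real (a + 1) * real (m choose (a + 1)) = real (m - a) * real (m choose a)"
    by (metis of_nat_mult)
  have pos: "real (m choose (a + 1)) > 0" "real (m choose a) > 0"
    using assms by simp_all
  have quot: "real (m - a) * real (m choose a) / real (m choose (a + 1)) = real (a + 1)"
    unfolding eq[symmetric] using pos by simp
  have "real ((a + 1) * (m - a)) =
      real (m - a) * (real (m - a) * real (m choose a) / real (m choose (a + 1)))"
    unfolding quot by (simp only: of_nat_mult mult.commute)
  also have "\<dots> = real (m - a) ^ 2 * (real (m choose a) / real (m choose (a + 1)))"
    by (simp only: power2_eq_square times_divide_eq_right mult.assoc)
  also have "sqrt \<dots> = real (m - a) * (sqrt (real (m choose a)) / sqrt (real (m choose (a + 1))))"
    by (simp add: real_sqrt_mult real_sqrt_divide)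
  finally have sqrt: "sqrt (real ((a + 1) * (m - a))) =
      real (m - a) * (sqrt (real (m choose a)) / sqrt (real (m choose (a + 1))))" .
  show ?thesis
    unfolding sqrt using pos by (simp add: powr_half_sqrt powr_minus_divide)
qed

theorem theorem1p2:
  fixes n :: nat
  assumes "n \<ge> 1"
  shows "pairwise (\<lambda>v w. inner_on (B n) v w = 0) (O_basis n)
    \<and> (\<forall>k x y u. k \<le> n div 2 \<longrightarrow> x \<in> O_chains_from n k \<longrightarrow> y \<in> O_chains_from n k \<longrightarrow>
         k \<le> u \<longrightarrow> u < n - k \<longrightarrow>
         norm_on (B n) (at_rank k x (u + 1)) / norm_on (B n) (at_rank k x u) =
         norm_on (B n) (at_rank k y (u + 1)) / norm_on (B n) (at_rank k y u))
    \<and> (\<forall>k x u. k \<le> n div 2 \<longrightarrow> x \<in> O_chains_from n k \<longrightarrow> k \<le> u \<longrightarrow> u < n - k \<longrightarrow>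
         norm_on (B n) (at_rank k x (u + 1)) / norm_on (B n) (at_rank k x u) =
           sqrt (real ((u + 1 - k) * (n - k - u)))
         \<and> sqrt (real ((u + 1 - k) * (n - k - u))) =
           real (n - k - u) * real ((n - 2 * k) choose (u - k)) powr (1 / 2)
             * real ((n - 2 * k) choose (u + 1 - k)) powr (- 1 / 2))"
proof (intro conjI allI impI)
  show "pairwise (\<lambda>v w. inner_on (B n) v w = 0) (O_basis n)"
    using assms by (rule O_basis_orthogonal)
next
  fix k u assume u: "k \<le> u" "u < n - k"
  then have e: "u - k < n - 2 * k" "u + 1 - k = (u - k) + 1" "n - k - u = n - 2 * k - (u - k)"
    by auto
  show "sqrt (real ((u + 1 - k) * (n - k - u))) =
      real (n - k - u) * real ((n - 2 * k) choose (u - k)) powr (1 / 2)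
        * real ((n - 2 * k) choose (u + 1 - k)) powr (- 1 / 2)"
    using sqrt_binomial_ratio[OF e(1)] by (simp only: e(2,3))
\<comment> \<open>In the equality for \<open>x\<close> and \<open>y\<close>, both sides rewrite to
  the same square root.\<close>
qed (simp_all only: O_chains_from_norm_ratio[OF assms])

end
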